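(* Let $x,q,a,b$ be positive real numbers with $x\in(0,1)$ and $a,b>1$. For $p\in(0,\infty)$ define $$\psi(p) = \left(\frac{\Phi_{p,q}(a,b;x)}{(1+a)^p(1+b)^q} - \frac{x}{1-x}\right)\frac{x-1}{px}.$$ Then $$\psi(p)\,\psi(p+2) - \psi(p+1)^2 \ge 0 \qquad \text{for all } p\in(0,\infty).$$
   Context: The generalized polylogarithm is $$\Phi_{p,q}(a,b;x) = \sum_{k=1}^\infty \frac{(1+a)^p(1+b)^q}{(k+a)^p(k+b)^q} x^k, \qquad |x|<1.$$ *)

theory Defs
  imports Complex_Main
begin

(* The real-parameter function. The sum over k >= 1 is shifted to an index running from 0.
   Since powr is the real power only for positive bases, the definition is meaningful
   for a, b > -1 and |x| < 1, where the series converges. *)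
definition gen_polylog :: "real \<Rightarrow> real \<Rightarrow> real \<Rightarrow> real \<Rightarrow> real \<Rightarrow> real" where
  "gen_polylog p q a b x =
     (\<Sum>k. ((1 + a) powr p * (1 + b) powr q) /
            ((real (Suc k) + a) powr p * (real (Suc k) + b) powr q) * x ^ Suc k)"

definition psi :: "real \<Rightarrow> real \<Rightarrow> real \<Rightarrow> real \<Rightarrow> real \<Rightarrow> real" where
  "psi q a b x p =
     (gen_polylog p q a b x / ((1 + a) powr p * (1 + b) powr q) - x / (1 - x)) *
     ((x - 1) / (p * x))"

end

theory Submission
  imports Defs
begin

text \<open>
  The geometric weights \<open>(1 - x) x\<^sup>k\<close> exhibit \<open>psi\<close> as an average over \<open>k\<close> of the functions
  \<open>p \<mapsto> (1 - c e\<^sup>-\<^sup>s\<^sup>p) / p\<close> with \<open>s > 0\<close> and \<open>0 < c \<le> 1\<close>. The inequality is inherited by averages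
  (Cauchy-Schwarz), so it suffices to prove it for each of these functions. With \<open>u = e\<^sup>-\<^sup>s\<close> and
  \<open>y = c u\<^sup>p\<close> it reads \<open>(p + 1)\<^sup>2 y (1 - u)\<^sup>2 \<le> (1 - y u)\<^sup>2\<close>. The worst case is \<open>c = 1\<close>, which is
  \<open>(p + 1) sinh (s / 2) \<le> sinh ((p + 1) s / 2)\<close>.
\<close>

text \<open>Both sides vanish at \<open>h = 0\<close>, and the derivative of their difference,
  \<open>r * (cosh (r * t) - cosh t)\<close>, is nonnegative because cosh increases on the
  nonnegative reals.\<close>

lemma mult_sinh_le_sinh_mult:
  fixes r h :: real
  assumes "1 \<le> r" and "0 \<le> h"
  shows "r * sinh h \<le> sinh (r * h)"
proof -
  have "sinh (r * 0) - r * sinh 0 \<le> sinh (r * h) - r * sinh h"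
  proof (rule DERIV_nonneg_imp_nondecreasing[OF \<open>0 \<le> h\<close>])
    fix t :: real assume "0 \<le> t" "t \<le> h"
    have "((\<lambda>t. sinh (r * t) - r * sinh t) has_real_derivative
            r * cosh (r * t) - r * cosh t) (at t)"
      by (auto intro!: derivative_eq_intros)
    moreover have "cosh t \<le> cosh (r * t)"
      using \<open>0 \<le> t\<close> assms mult_right_mono[of 1 r t]
      by (subst cosh_real_nonneg_le_iff) auto
    hence "0 \<le> r * cosh (r * t) - r * cosh t"
      using assms by (simp add: mult_left_mono)
    ultimately show "\<exists>d. ((\<lambda>t. sinh (r * t) - r * sinh t) has_real_derivative d) (at t) \<and> 0 \<le> d"
      by blast
  qed
  thus ?thesis by simp
qed

text \<open>This is the sinh inequality at \<open>r = p + 1\<close>, \<open>h = s / 2\<close>,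
  multiplied by \<open>2 * ?E\<close>; the exponential factors turn each sinh into a difference
  \<open>1 - exp (- v)\<close>.\<close>

lemma mult_exp_diff_le:
  fixes p s :: real
  assumes "0 \<le> p" and "0 \<le> s"
  shows "(p + 1) * exp (- (s * p / 2)) * (1 - exp (- s)) \<le> 1 - exp (- (s * (p + 1)))"
proof -
  let ?E = "exp (- (s * (p + 1) / 2))"
  have sinh: "2 * sinh (v / 2) * exp (- (v / 2)) = 1 - exp (- v)" for v :: real
  proof -
    have "exp (v / 2) * exp (- (v / 2)) = 1" "exp (- (v / 2)) * exp (- (v / 2)) = exp (- v)"
      by (simp_all flip: exp_add)
    thus ?thesis by (simp add: sinh_def algebra_simps)
  qed
  have "exp (- (s * p / 2)) * exp (- (s / 2)) = ?E"
    by (simp flip: exp_add add: field_simps)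
  hence "(p + 1) * exp (- (s * p / 2)) * (1 - exp (- s)) = 2 * ?E * ((p + 1) * sinh (s / 2))"
    by (simp flip: sinh)
  also have "\<dots> \<le> 2 * ?E * sinh ((p + 1) * (s / 2))"
    using assms by (intro mult_left_mono mult_sinh_le_sinh_mult) auto
  also have "\<dots> = 1 - exp (- (s * (p + 1)))"
    using sinh[of "s * (p + 1)"] by (simp add: mult_ac)
  finally show ?thesis .
qed

lemma one_minus_exp_div_log_convex:
  fixes p s c :: real
  assumes "0 < p" and "0 \<le> s" and "0 \<le> c" and "c \<le> 1"
  defines "f \<equiv> \<lambda>p. (1 - c * exp (- (s * p))) / p"
  shows "(f (p + 1))\<^sup>2 \<le> f p * f (p + 2)"
proof -
  define u where "u = exp (- s)"
  define w where "w = exp (- (s * p / 2))"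
  \<comment> \<open>Here z^2 is the y of the overview. Passing from \<open>z\<close> to its upper
    bound \<open>w\<close> (the case c = 1) raises (p + 1) z (1 - u) and lowers 1 - z^2 u, so the
    bound for \<open>w\<close> suffices.\<close>
  define z where "z = sqrt c * w"
  have u: "0 < u" "u \<le> 1" and w: "0 < w"
    using assms by (simp_all add: u_def w_def)
  have z: "0 \<le> z" "z \<le> w"
    using assms w by (auto simp: z_def intro!: mult_left_le_one_le)
  have ww: "w\<^sup>2 = exp (- (s * p))"
    by (simp add: w_def power2_eq_square flip: exp_add)
  have zz: "z\<^sup>2 = c * w\<^sup>2"
    using assms by (simp add: z_def power_mult_distrib)
  have e1: "exp (- (s * (p + 1))) = w\<^sup>2 * u"
    by (simp add: ww u_def algebra_simps flip: exp_add)
  have e2: "exp (- (s * (p + 2))) = w\<^sup>2 * u\<^sup>2"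
    by (simp add: ww u_def algebra_simps flip: exp_add exp_double)
  have "(p + 1) * z * (1 - u) \<le> (p + 1) * w * (1 - u)"
    using assms u z by (intro mult_right_mono mult_left_mono) auto
  also have "\<dots> \<le> 1 - w\<^sup>2 * u"
    using mult_exp_diff_le[of p s] assms e1 by (simp add: u_def w_def)
  also have "\<dots> \<le> 1 - z\<^sup>2 * u"
    using u z by (simp add: mult_right_mono power_mono)
  finally have "((p + 1) * z * (1 - u))\<^sup>2 \<le> (1 - z\<^sup>2 * u)\<^sup>2"
    using assms u z by (intro power_mono) auto
  \<comment> \<open>With y = z^2, this rests on (1 - y) (1 - y u^2) = (1 - y u)^2 - y (1 - u)^2 and
    (p + 1)^2 = p (p + 2) + 1.\<close>
  hence "p * (p + 2) * (1 - z\<^sup>2 * u)\<^sup>2 \<le> (p + 1)\<^sup>2 * ((1 - z\<^sup>2) * (1 - z\<^sup>2 * u\<^sup>2))"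
    by (simp add: power2_eq_square algebra_simps)
  hence "(1 - z\<^sup>2 * u)\<^sup>2 / (p + 1)\<^sup>2 \<le> (1 - z\<^sup>2) * (1 - z\<^sup>2 * u\<^sup>2) / (p * (p + 2))"
    using assms by (simp add: divide_simps mult_ac)
  thus ?thesis
    unfolding f_def e1 e2 by (simp add: zz ww[symmetric] power_divide mult.assoc)
qed

text \<open>The quadratic F + 2 t G + t^2 H in the three sums is nonnegative for every t, since it
  is so term by term; hence its discriminant is not positive.\<close>

lemma suminf_Cauchy_Schwarz:
  fixes f g h :: "nat \<Rightarrow> real"
  assumes "summable f" and "summable g" and "summable h"
    and f: "\<And>n. 0 \<le> f n" and h: "\<And>n. 0 \<le> h n" and g: "\<And>n. (g n)\<^sup>2 \<le> f n * h n"
  shows "(suminf g)\<^sup>2 \<le> suminf f * suminf h"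
proof -
  let ?F = "suminf f" and ?G = "suminf g" and ?H = "suminf h"
  have quad: "0 \<le> ?F + 2 * t * ?G + t\<^sup>2 * ?H" for t
  proof -
    have "0 \<le> f n + 2 * t * g n + t\<^sup>2 * h n" for n
    proof (cases "h n = 0")
      case True
      thus ?thesis using f[of n] g[of n] by simp
    next
      case False
      have "0 \<le> (f n * h n - (g n)\<^sup>2) + (g n + t * h n)\<^sup>2"
        using g[of n] by simp
      also have "\<dots> = h n * (f n + 2 * t * g n + t\<^sup>2 * h n)"
        by (simp add: power2_eq_square algebra_simps)
      finally show ?thesis
        using False h[of n] by (simp add: zero_le_mult_iff)
    qed
    moreover have "(\<lambda>n. f n + 2 * t * g n + t\<^sup>2 * h n) sums (?F + 2 * t * ?G + t\<^sup>2 * ?H)"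
      using assms by (intro sums_add sums_mult summable_sums)
    ultimately show ?thesis
      by (rule sums_le[OF _ sums_zero])
  qed
  show ?thesis
  proof (cases "?H = 0")
    case True
    have "?G = 0"
    proof (rule ccontr)
      assume "?G \<noteq> 0"
      thus False
        \<comment> \<open>For H = 0 the quadratic is affine in t, and this t gives it the value
          -1.\<close>
        using quad[of "- (?F + 1) / (2 * ?G)"] True by (simp add: field_simps)
    qed
    thus ?thesis using True by simp
  next
    case False
    moreover have "0 \<le> ?H"
      using assms by (intro suminf_nonneg)
    ultimately have "0 < ?H" by simp
    \<comment> \<open>The point t = - G / H minimizes the quadratic.\<close>
    have "?F + 2 * (- ?G / ?H) * ?G + (- ?G / ?H)\<^sup>2 * ?H = (?F * ?H - ?G\<^sup>2) / ?H"
      using False by (simp add: field_simps power2_eq_square)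
    with quad[of "- ?G / ?H"] \<open>0 < ?H\<close> show ?thesis
      by (simp add: zero_le_divide_iff)
  qed
qed

text \<open>Since x / (1 - x) is the sum of \<open>x * x ^ k\<close>, the bracket in
  \<open>psi\<close> is a single series, and the factor (x - 1) / (p x) makes its terms nonnegative.
  The power of k + 1 + a is written with exp and ln to expose the shape c e^(-sp).\<close>

lemma psi_sums:
  fixes x q a b p :: real
  assumes "0 < x" and "x < 1" and "0 < q" and "0 < a" and "0 < b" and "0 < p"
  shows "(\<lambda>k. (1 - x) * x ^ k *
            ((1 - (real (Suc k) + b) powr - q * exp (- (ln (real (Suc k) + a) * p))) / p))
         sums psi q a b x p"
proof -
  define d where "d k = (real (Suc k) + b) powr - q * exp (- (ln (real (Suc k) + a) * p))" for k
  define D where "D = (1 + a) powr p * (1 + b) powr q"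
  have "D \<noteq> 0" using assms by (simp add: D_def)
  have d: "d k = 1 / ((real (Suc k) + a) powr p * (real (Suc k) + b) powr q)" for k
    using assms by (simp add: d_def powr_def exp_minus field_simps)
  have d_bounds: "0 \<le> d k \<and> d k \<le> 1" for k
    using assms by (auto simp: d_def powr_minus intro!: mult_le_one inverse_le_1_iff[THEN iffD2] ge_one_powr_ge_zero)
  have geom: "(\<lambda>k. x ^ k) sums (1 / (1 - x))"
    using assms by (intro geometric_sums) simp
  have "summable (\<lambda>k. d k * x ^ Suc k)"
  proof (rule summable_comparison_test'[where N = 0])
    show "summable (\<lambda>k. x * x ^ k)"
      using geom by (intro summable_mult sums_summable)
    show "norm (d k * x ^ Suc k) \<le> x * x ^ k" for k
      using d_bounds[of k] assms by (simp add: abs_mult mult_left_le_one_le)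
  qed
  hence d_sums: "(\<lambda>k. d k * x ^ Suc k) sums (\<Sum>k. d k * x ^ Suc k)"
    by (rule summable_sums)
  have "gen_polylog p q a b x = (\<Sum>k. D * (d k * x ^ Suc k))"
    unfolding gen_polylog_def D_def d by simp
  also have "\<dots> = D * (\<Sum>k. d k * x ^ Suc k)"
    using d_sums by (intro suminf_mult sums_summable)
  finally have "gen_polylog p q a b x / D = (\<Sum>k. d k * x ^ Suc k)"
    using \<open>D \<noteq> 0\<close> by simp
  hence "(\<lambda>k. (d k * x ^ Suc k - x * x ^ k) * ((x - 1) / (p * x))) sums psi q a b x p"
    unfolding psi_def D_def[symmetric]
    using sums_mult2[OF sums_diff[OF d_sums sums_mult[OF geom, of x]], of "(x - 1) / (p * x)"]
    by simp
  moreover have "(d k * x ^ Suc k - x * x ^ k) * ((x - 1) / (p * x))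
      = (1 - x) * x ^ k * ((1 - d k) / p)" for k
    using assms by (simp add: field_simps)
  ultimately show ?thesis
    by (simp add: d_def)
qed

theorem corollary3p5:
  fixes x q a b :: real
  assumes "0 < x" and "x < 1" and "0 < q" and "1 < a" and "1 < b"
  shows "\<forall>p\<in>{0<..}. psi q a b x p * psi q a b x (p + 2) - (psi q a b x (p + 1))\<^sup>2 \<ge> 0"
proof
  fix p :: real assume "p \<in> {0<..}"
  hence p: "0 < p" by simp
  \<comment> \<open>Neither \<open>c k\<close> nor \<open>s k\<close> depends on the exponent
    \<open>r\<close>, so the values of psi at p, p + 1 and p + 2 average the same family with the
    same weights.\<close>
  define c where "c k = (real (Suc k) + b) powr - q" for k
  define s where "s k = ln (real (Suc k) + a)" for k
  define f where "f r k = (1 - c k * exp (- (s k * r))) / r" for r k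
  define g where "g r k = (1 - x) * x ^ k * f r k" for r k
  have c: "0 \<le> c k" "c k \<le> 1" and s: "0 \<le> s k" for k
    using assms by (auto simp: c_def s_def powr_minus intro!: inverse_le_1_iff[THEN iffD2] ge_one_powr_ge_zero)
  have sums: "g r sums psi q a b x r" if "0 < r" for r
    unfolding g_def f_def c_def s_def using assms that by (intro psi_sums) auto
  have nonneg: "0 \<le> g r k" if "0 < r" for r k
  proof -
    have "c k * exp (- (s k * r)) \<le> 1"
      using that c[of k] s[of k] by (intro mult_le_one) auto
    thus ?thesis
      using assms that by (simp add: g_def f_def)
  qed
  have "(g (p + 1) k)\<^sup>2 \<le> g p k * g (p + 2) k" for k
  proof -
    have "(f (p + 1) k)\<^sup>2 \<le> f p k * f (p + 2) k"
      unfolding f_def using p s c by (rule one_minus_exp_div_log_convex)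
    \<comment> \<open>Both sides are of degree two in the common weight, so the termwise inequality
      survives weighting.\<close>
    hence "((1 - x) * x ^ k)\<^sup>2 * (f (p + 1) k)\<^sup>2 \<le> ((1 - x) * x ^ k)\<^sup>2 * (f p k * f (p + 2) k)"
      by (rule mult_left_mono) simp
    thus ?thesis
      by (simp add: g_def power2_eq_square mult_ac)
  qed
  hence "(suminf (g (p + 1)))\<^sup>2 \<le> suminf (g p) * suminf (g (p + 2))"
    using p by (intro suminf_Cauchy_Schwarz nonneg sums_summable[OF sums]) auto
  thus "psi q a b x p * psi q a b x (p + 2) - (psi q a b x (p + 1))\<^sup>2 \<ge> 0"
    using p by (simp flip: sums_unique[OF sums])
qed

end
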